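(* Let $m,n\ge 3$, let $\mathcal{C}_m$ and $\mathcal{C}_m'$ be $m$-gon categories, let $T$ be a directed $\{m,n\}$ tiling on $\mathcal{C}_m$ of a topological space $X$, and let $\tau\colon T\to\Lambda_{\mathcal{C}_m'}$ be a map of presheaves on $\mathcal{C}_m$. Then there is a directed $\{m,n\}$ tiling $T'$ on $\mathcal{C}_m'$ of $X$ whose underlying directed graph is obtained from that of $T$ by reversing the direction of every edge $e\in T_1$ with $\tau(e)=-1$ (and keeping the direction of every edge $e$ with $\tau(e)=1$).
   Context: **$m$-gon categories.** For $m\ge 3$, an $m$-gon category $\mathcal{C}_m$ has three objects $0,1,2$ and exactly the following (distinct) non-identity morphisms: $s,t\colon 0\to 1$; $d^1,\dots,d^m\colon 1\to 2$; $v^1,\dots,v^m\colon 0\to 2$; with composition satisfying $\{d^i\circ s,\,d^i\circ t\}=\{v^i,v^{i+1}\}$ for $i=1,\dots,m$ (indices mod $m$, in $\{1,\dots,m\}$). There are $2^m$ of them, indexed by the tuple $\delta^{\mathcal{C}_m}\in\{1,-1\}^m$ with $\delta^{\mathcal{C}_m}_i=1$ if $d^i\circ s=v^i$ and $\delta^{\mathcal{C}_m}_i=-1$ if $d^i\circ t=v^i$. **Presheaves.** A presheaf $T$ on $\mathcal{C}_m$ has sets $T_0$ (vertices), $T_1$ (edges), $T_2$ (tiles) and structure maps $s,t\colon T_1\to T_0$, $d_1,\dots,d_m\colon T_2\to T_1$ (and $v_1,\dots,v_m\colon T_2\to T_0$) induced by $s,t,d^i,v^i$. Its underlying directed graph has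 vertex set $T_0$, edge set $T_1$, with source and target maps $s,t$. Let $y(i)=\mathrm{Hom}(-,i)$ be the representable presheaf. The geometric realization $|T|$ is taken with respect to the functor $\mathcal{C}_m\to\mathsf{Top}$ sending $0$ to a point, $1$ to an interval, $2$ to a standard (filled) $m$-gon, $s,t$ to the endpoint inclusions and $d^1,\dots,d^m$ to the successive edge inclusions (so $|T|$ is the colimit over the category of elements of $T$). **Directed tilings.** A directed $\{m,n\}$ tiling on $\mathcal{C}_m$ of a space $X$ is a presheaf $T$ on $\mathcal{C}_m$ such that: (1) $T$ is nonsingular: for each $x\in T_i$ the corresponding map $y(i)\to T$ is levelwise injective; (2) any two distinct tiles have at most one edge in common; (3) each vertex $v\in T_0$ has exactly $n$ edges $e$ with $s(e)=v$ or $t(e)=v$; (4) $|T|$ is homeomorphic to $X$. **Dihedral action.** The dihedral group $\mathsf{D}_m$ of order $2m$, generated by a rotation $r$ and a reflection $f$, acts on $\{1,-1\}^m$ by $r(\delta_1,\dots,\delta_m)=(\delta_2,\dots,\delta_m,\delta_1)$ and $f(\delta_1,\dots,\delta_m)=(-\delta_m,\dots,-\delta_1)$. Products of tuples are componentwise. **Direction presheaves.** The presheaf $\Lambda$ on $\mathcal{C}_m$ has $\Lambda_0=\{*\}$, $\Lambda_1=\{1,-1\}$, $\Lambda_2=\{1,-1\}^m$, with $d_i=\pi_i$ the $i$-th projection. For another $m$-gon category $\mathcal{C}_m'$, $\Lambda_{\mathcal{C}_m'}$ is the sub-presheaf of $\Lambda$ with the same $0$- and $1$-components and $(\Lambda_{\mathcal{C}_m'})_2=\{\delta^{\mathcal{C}_m}\cdot\sigma(\delta^{\mathcal{C}_m'})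 : \sigma\in\mathsf{D}_m\}$. For an edge $e\in T_1$, $\tau(e)\in\{1,-1\}$ is the value of the component $\tau_1\colon T_1\to\Lambda_1$. *)

theory Defs
  imports "HOL-Analysis.Analysis"
begin

section \<open>The $m$-gon categories\<close>

datatype ob = Ob0 | Ob1 | Ob2

text \<open>
  The morphisms of an $m$-gon category: identities, \<open>MorS, MorT : 0 \<rightarrow> 1\<close>, \<open>MorD i : 1 \<rightarrow> 2\<close> and
  \<open>MorV i : 0 \<rightarrow> 2\<close>.  The indices are those in \<open>{1..m}\<close>.
\<close>

datatype mor = Ident ob | MorS | MorT | MorD nat | MorV nat

fun mdom :: "mor \<Rightarrow> ob" where
  "mdom (Ident a) = a"
| "mdom MorS = Ob0"
| "mdom MorT = Ob0"
| "mdom (MorD i) = Ob1"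
| "mdom (MorV i) = Ob0"

fun mcod :: "mor \<Rightarrow> ob" where
  "mcod (Ident a) = a"
| "mcod MorS = Ob1"
| "mcod MorT = Ob1"
| "mcod (MorD i) = Ob2"
| "mcod (MorV i) = Ob2"

definition arrows :: "nat \<Rightarrow> mor set" where
  "arrows m = range Ident \<union> {MorS, MorT} \<union> MorD ` {1..m} \<union> MorV ` {1..m}"

definition hom_set :: "nat \<Rightarrow> ob \<Rightarrow> ob \<Rightarrow> mor set" where
  "hom_set m a b = {f \<in> arrows m. mdom f = a \<and> mcod f = b}"

definition next_index :: "nat \<Rightarrow> nat \<Rightarrow> nat" where
  "next_index m i = (if i = m then 1 else i + 1)"

text \<open>
  Objects and morphisms being fixed, an $m$-gon category is given by its composition; \<open>C g f\<close> is
  $g \circ f$, and its value is irrelevant unless \<open>g\<close> and \<open>f\<close> are composable.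
\<close>

type_synonym composition = "mor \<Rightarrow> mor \<Rightarrow> mor"

definition is_category :: "nat \<Rightarrow> composition \<Rightarrow> bool" where
  "is_category m C \<longleftrightarrow>
     (\<forall>a b c. \<forall>f\<in>hom_set m a b. \<forall>g\<in>hom_set m b c. C g f \<in> hom_set m a c) \<and>
     (\<forall>a b. \<forall>f\<in>hom_set m a b. C f (Ident a) = f \<and> C (Ident b) f = f) \<and>
     (\<forall>a b c d. \<forall>f\<in>hom_set m a b. \<forall>g\<in>hom_set m b c. \<forall>h\<in>hom_set m c d.
        C h (C g f) = C (C h g) f)"

definition mgon_category :: "nat \<Rightarrow> composition \<Rightarrow> bool" where
  "mgon_category m C \<longleftrightarrow> m \<ge> 3 \<and> is_category m C \<and>
     (\<forall>i\<in>{1..m}. {C (MorD i) MorS, C (MorD i) MorT} = {MorV i, MorV (next_index m i)})"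

text \<open>
  The sign \<open>\<delta>\<^sub>i\<close>; in an $m$-gon category the alternative to $d^i \circ s = v^i$ is $d^i \circ t = v^i$.
\<close>

definition sign_at :: "composition \<Rightarrow> nat \<Rightarrow> int" where
  "sign_at C i = (if C (MorD i) MorS = MorV i then 1 else -1)"

text \<open>Tuples in \<open>{1,-1}\<^sup>m\<close> are lists of length \<open>m\<close>, so the \<open>i\<close>-th entry of \<open>xs\<close> is \<open>xs ! (i - 1)\<close>.\<close>

definition sign_tuple :: "nat \<Rightarrow> composition \<Rightarrow> int list" where
  "sign_tuple m C = map (sign_at C) [1..<Suc m]"


section \<open>Presheaves\<close>

record ('v, 'e, 'f) presheaf =
  Verts :: "'v set"
  Edges :: "'e set"
  Tiles :: "'f set"
  src :: "'e \<Rightarrow> 'v"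
  tgt :: "'e \<Rightarrow> 'v"
  bd :: "nat \<Rightarrow> 'f \<Rightarrow> 'e"
  corner :: "nat \<Rightarrow> 'f \<Rightarrow> 'v"

datatype ('v, 'e, 'f) elem = Vert 'v | Edge 'e | Tile 'f

fun elems :: "('v, 'e, 'f) presheaf \<Rightarrow> ob \<Rightarrow> ('v, 'e, 'f) elem set" where
  "elems T Ob0 = Vert ` Verts T"
| "elems T Ob1 = Edge ` Edges T"
| "elems T Ob2 = Tile ` Tiles T"

text \<open>The action of a morphism \<open>f : a \<rightarrow> b\<close> as a map from \<open>elems T b\<close> to \<open>elems T a\<close>.\<close>

fun act :: "('v, 'e, 'f) presheaf \<Rightarrow> mor \<Rightarrow> ('v, 'e, 'f) elem \<Rightarrow> ('v, 'e, 'f) elem" where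
  "act T (Ident a) x = x"
| "act T MorS (Edge e) = Vert (src T e)"
| "act T MorT (Edge e) = Vert (tgt T e)"
| "act T (MorD i) (Tile x) = Edge (bd T i x)"
| "act T (MorV i) (Tile x) = Vert (corner T i x)"
| "act _ _ _ = undefined"

text \<open>Contravariant functoriality; identities are respected by definition of \<^const>\<open>act\<close>.\<close>

definition presheaf_on :: "nat \<Rightarrow> composition \<Rightarrow> ('v, 'e, 'f) presheaf \<Rightarrow> bool" where
  "presheaf_on m C T \<longleftrightarrow>
     (\<forall>a b. \<forall>f\<in>hom_set m a b. \<forall>x\<in>elems T b. act T f x \<in> elems T a) \<and>
     (\<forall>a b c. \<forall>f\<in>hom_set m a b. \<forall>g\<in>hom_set m b c. \<forall>x\<in>elems T c.
        act T (C g f) x = act T f (act T g x))"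

definition presheaf_map ::
  "nat \<Rightarrow> ('v, 'e, 'f) presheaf \<Rightarrow> ('w, 'g, 'h) presheaf \<Rightarrow>
   ('v \<Rightarrow> 'w) \<Rightarrow> ('e \<Rightarrow> 'g) \<Rightarrow> ('f \<Rightarrow> 'h) \<Rightarrow> bool" where
  "presheaf_map m T U h0 h1 h2 \<longleftrightarrow>
     (\<forall>a. \<forall>x\<in>elems T a. map_elem h0 h1 h2 x \<in> elems U a) \<and>
     (\<forall>a b. \<forall>f\<in>hom_set m a b. \<forall>x\<in>elems T b.
        map_elem h0 h1 h2 (act T f x) = act U f (map_elem h0 h1 h2 x))"


section \<open>Geometric realization\<close>

definition polygon_vertex :: "nat \<Rightarrow> nat \<Rightarrow> complex" where
  "polygon_vertex m i = cis (2 * pi * real i / real m)"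

fun cell :: "nat \<Rightarrow> ob \<Rightarrow> complex set" where
  "cell m Ob0 = {0}"
| "cell m Ob1 = complex_of_real ` {0..1}"
| "cell m Ob2 = convex hull (polygon_vertex m ` {1..m})"

text \<open>
  $d^i$ maps the interval affinely onto the edge between the $i$-th and the next vertex of the polygon,
  in the direction which makes the assignment functorial.
\<close>

fun cell_map :: "nat \<Rightarrow> composition \<Rightarrow> mor \<Rightarrow> complex \<Rightarrow> complex" where
  "cell_map m C (Ident a) p = p"
| "cell_map m C MorS p = 0"
| "cell_map m C MorT p = 1"
| "cell_map m C (MorD i) p =
     (if sign_at C i = 1
      then linepath (polygon_vertex m i) (polygon_vertex m (next_index m i)) (Re p)
      else linepath (polygon_vertex m (next_index m i)) (polygon_vertex m i) (Re p))"
| "cell_map m C (MorV i) p = polygon_vertex m i"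

definition cells_topology :: "nat \<Rightarrow> ('v, 'e, 'f) presheaf \<Rightarrow> (('v, 'e, 'f) elem \<times> complex) topology" where
  "cells_topology m T =
     sum_topology (\<lambda>x. subtopology euclidean (\<Union>b\<in>{b. x \<in> elems T b}. cell m b)) (\<Union>b. elems T b)"

definition glue :: "nat \<Rightarrow> composition \<Rightarrow> ('v, 'e, 'f) presheaf \<Rightarrow> (('v, 'e, 'f) elem \<times> complex) rel" where
  "glue m C T =
     {((act T f x, p), (x, cell_map m C f p)) | f x p a b.
        f \<in> hom_set m a b \<and> x \<in> elems T b \<and> p \<in> cell m a}"

definition quotient_space :: "'a topology \<Rightarrow> 'a rel \<Rightarrow> 'a set topology" where
  "quotient_space X r = topology (\<lambda>U. U \<subseteq> topspace X // r \<and> openin X (\<Union>U))"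

lemma openin_quotient_space:
  assumes "equiv (topspace X) r"
  shows "openin (quotient_space X r) U \<longleftrightarrow> U \<subseteq> topspace X // r \<and> openin X (\<Union>U)"
proof -
  have "\<Union>(U \<inter> V) = \<Union>U \<inter> \<Union>V" if "U \<subseteq> topspace X // r" "V \<subseteq> topspace X // r" for U V
  proof
    show "\<Union>U \<inter> \<Union>V \<subseteq> \<Union>(U \<inter> V)"
    proof
      fix z assume "z \<in> \<Union>U \<inter> \<Union>V"
      then obtain A B where "A \<in> U" "B \<in> V" "z \<in> A" "z \<in> B" by blast
      then have "A = B"
        using quotient_disj[OF assms, of A B] that by blast
      then show "z \<in> \<Union>(U \<inter> V)" using \<open>A \<in> U\<close> \<open>B \<in> V\<close> \<open>z \<in> A\<close> by blast
    qed
  qed blast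
  then have "istopology (\<lambda>U. U \<subseteq> topspace X // r \<and> openin X (\<Union>U))"
    unfolding istopology_def
  proof (intro conjI allI impI)
    fix K assume K: "\<forall>U\<in>K. U \<subseteq> topspace X // r \<and> openin X (\<Union>U)"
    have "\<Union>(\<Union>K) = \<Union>(Union ` K)"
      by blast
    moreover have "openin X (\<Union>(Union ` K))"
      using K by (intro openin_Union) blast
    ultimately show "openin X (\<Union>(\<Union>K))"
      by (rule ssubst)
    show "\<Union>K \<subseteq> topspace X // r"
      using K by blast
  qed (auto simp only: openin_Int)
  then show ?thesis
    by (simp add: quotient_space_def)
qed

text \<open>
  The colimit over the category of elements: the coproduct of the cells of all elements, modulo the
  equivalence relation generated by \<^const>\<open>glue\<close>.
\<close>

definition glue_equiv :: "nat \<Rightarrow> composition \<Rightarrow> ('v, 'e, 'f) presheaf \<Rightarrow> (('v, 'e, 'f) elem \<times> complex) rel" where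
  "glue_equiv m C T =
     (glue m C T \<union> (glue m C T)\<inverse>)\<^sup>* \<inter> topspace (cells_topology m T) \<times> topspace (cells_topology m T)"

definition realization ::
  "nat \<Rightarrow> composition \<Rightarrow> ('v, 'e, 'f) presheaf \<Rightarrow> (('v, 'e, 'f) elem \<times> complex) set topology" where
  "realization m C T = quotient_space (cells_topology m T) (glue_equiv m C T)"

lemma equiv_glue_equiv: "equiv (topspace (cells_topology m T)) (glue_equiv m C T)"
proof -
  have "sym ((glue m C T \<union> (glue m C T)\<inverse>)\<^sup>*)"
    by (intro sym_rtrancl sym_Un_converse)
  then show ?thesis
    unfolding glue_equiv_def
    by (intro equivI) (auto simp: refl_on_def sym_def intro!: transI)
qed

lemma cell_map_in_cell:
  assumes "m \<ge> 3" "f \<in> hom_set m a b" "p \<in> cell m a"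
  shows "cell_map m C f p \<in> cell m b"
proof -
  have vertex: "polygon_vertex m i \<in> convex hull (polygon_vertex m ` {1..m})" if "i \<in> {1..m}" for i
    using that by (intro hull_inc) auto
  have nxt: "next_index m i \<in> {1..m}" if "i \<in> {1..m}" for i
    using that by (auto simp: next_index_def)
  have line: "linepath x y t \<in> convex hull A"
    if "x \<in> convex hull A" "y \<in> convex hull A" "t \<in> {0..1}" for x y :: complex and t A
    using that by (metis closed_segment_subset_convex_hull linepath_in_path subsetD)
  show ?thesis
    using assms vertex nxt line
    by (auto simp: hom_set_def arrows_def image_iff intro: bexI[of _ "0::real"] bexI[of _ "1::real"])
qed

lemma cell_map_functorial:
  assumes "mgon_category m C" "f \<in> hom_set m a b" "g \<in> hom_set m b c" "p \<in> cell m a"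
  shows "cell_map m C (C g f) p = cell_map m C g (cell_map m C f p)"
proof -
  have cat: "is_category m C" and m: "m \<ge> 3"
    and bdry: "\<And>i. i \<in> {1..m} \<Longrightarrow>
      {C (MorD i) MorS, C (MorD i) MorT} = {MorV i, MorV (next_index m i)}"
    using assms(1) by (auto simp: mgon_category_def)
  have unit: "\<And>a b f. f \<in> hom_set m a b \<Longrightarrow> C f (Ident a) = f \<and> C (Ident b) f = f"
    using cat by (simp add: is_category_def)
  consider (l) "g = Ident b" "b = c" | (r) "f = Ident b" "a = b"
    | (S) i where "i \<in> {1..m}" "g = MorD i" "f = MorS"
    | (T) i where "i \<in> {1..m}" "g = MorD i" "f = MorT"
    using assms(2,3) by (auto simp: hom_set_def arrows_def)
  then show ?thesis
  proof cases
    case l with unit[OF assms(2)] show ?thesis by simp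
  next
    case r with unit[OF assms(3)] show ?thesis by simp
  next
    case S
    have "next_index m i \<noteq> i" using S m by (auto simp: next_index_def)
    with bdry[OF S(1)] S show ?thesis
      by (auto simp: sign_at_def linepath_def doubleton_eq_iff)
  next
    case T
    have "next_index m i \<noteq> i" using T m by (auto simp: next_index_def)
    with bdry[OF T(1)] T show ?thesis
      by (auto simp: sign_at_def linepath_def doubleton_eq_iff)
  qed
qed


section \<open>Directed tilings\<close>

text \<open>
  By Yoneda the map \<open>y(b) \<rightarrow> T\<close> corresponding to \<open>x \<in> elems T b\<close> has the components
  \<open>\<lambda>g. act T g x\<close> on \<open>y(b)(a) = hom_set m a b\<close>.
\<close>

definition nonsingular :: "nat \<Rightarrow> ('v, 'e, 'f) presheaf \<Rightarrow> bool" where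
  "nonsingular m T \<longleftrightarrow>
     (\<forall>b. \<forall>x\<in>elems T b. \<forall>a. inj_on (\<lambda>g. act T g x) (hom_set m a b))"

definition tile_edges :: "nat \<Rightarrow> ('v, 'e, 'f) presheaf \<Rightarrow> 'f \<Rightarrow> 'e set" where
  "tile_edges m T x = (\<lambda>i. bd T i x) ` {1..m}"

definition incident_edges :: "('v, 'e, 'f) presheaf \<Rightarrow> 'v \<Rightarrow> 'e set" where
  "incident_edges T v = {e \<in> Edges T. src T e = v \<or> tgt T e = v}"

definition directed_tiling ::
  "nat \<Rightarrow> nat \<Rightarrow> composition \<Rightarrow> ('v, 'e, 'f) presheaf \<Rightarrow> 'x topology \<Rightarrow> bool" where
  "directed_tiling m n C T X \<longleftrightarrow>
     presheaf_on m C T \<and>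
     nonsingular m T \<and>
     (\<forall>x\<in>Tiles T. \<forall>y\<in>Tiles T. x \<noteq> y \<longrightarrow> card (tile_edges m T x \<inter> tile_edges m T y) \<le> 1) \<and>
     (\<forall>v\<in>Verts T. finite (incident_edges T v) \<and> card (incident_edges T v) = n) \<and>
     realization m C T homeomorphic_space X"


section \<open>Direction presheaves\<close>

definition reflect :: "int list \<Rightarrow> int list" where
  "reflect \<delta> = map uminus (rev \<delta>)"

text \<open>
  The rotation is \<^const>\<open>rotate1\<close>.  On lists of length \<open>m\<close> the two generators have finite order, so the
  maps obtained by composing them are exactly those by which the elements of the dihedral group act.
\<close>

inductive_set dihedral_maps :: "(int list \<Rightarrow> int list) set" where
  one: "id \<in> dihedral_maps"
| rotation: "\<sigma> \<in> dihedral_maps \<Longrightarrow> rotate1 \<circ> \<sigma> \<in> dihedral_maps"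
| reflection: "\<sigma> \<in> dihedral_maps \<Longrightarrow> reflect \<circ> \<sigma> \<in> dihedral_maps"

definition all_directions :: "nat \<Rightarrow> (unit, int, int list) presheaf" where
  "all_directions m =
     \<lparr> Verts = {()}, Edges = {1, -1}, Tiles = {\<delta>. length \<delta> = m \<and> set \<delta> \<subseteq> {1, -1}},
       src = (\<lambda>_. ()), tgt = (\<lambda>_. ()), bd = (\<lambda>i \<delta>. \<delta> ! (i - 1)), corner = (\<lambda>_ _. ()) \<rparr>"

text \<open>The sub-presheaf (on \<open>C\<close>) for the target category \<open>C'\<close>.\<close>

definition directions :: "nat \<Rightarrow> composition \<Rightarrow> composition \<Rightarrow> (unit, int, int list) presheaf" where
  "directions m C C' =
     (all_directions m) \<lparr> Tiles :=
        {map2 (*) (sign_tuple m C) (\<sigma> (sign_tuple m C')) | \<sigma>. \<sigma> \<in> dihedral_maps} \<rparr>"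

lemma directions_subset: "Tiles (directions m C C') \<subseteq> Tiles (all_directions m)"
proof -
  have \<sigma>: "length (\<sigma> \<delta>) = length \<delta> \<and> set (\<sigma> \<delta>) \<subseteq> {1, -1}"
    if "\<sigma> \<in> dihedral_maps" "set \<delta> \<subseteq> {1, -1}" for \<sigma> \<delta>
    using that by (induction rule: dihedral_maps.induct) (auto simp: reflect_def)
  have signs: "set (sign_tuple m C) \<subseteq> {1, -1}" "length (sign_tuple m C) = m" for C
    by (auto simp: sign_tuple_def sign_at_def)
  have times: "set (map2 (*) xs ys) \<subseteq> {1, -1}" if "set xs \<subseteq> {1, -1}" "set ys \<subseteq> {1, -1}"
    for xs ys :: "int list"
    using that by (fastforce dest: set_zip_leftD set_zip_rightD)
  show ?thesis
  proof
    fix x assume "x \<in> Tiles (directions m C C')"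
    then obtain \<sigma> where "\<sigma> \<in> dihedral_maps"
      and x: "x = map2 (*) (sign_tuple m C) (\<sigma> (sign_tuple m C'))"
      by (auto simp: directions_def)
    then have "length (\<sigma> (sign_tuple m C')) = m" "set (\<sigma> (sign_tuple m C')) \<subseteq> {1, -1}"
      using \<sigma>[OF _ signs(1)] signs(2) by metis+
    then have "length x = m" "set x \<subseteq> {1, -1}"
      using times[OF signs(1)] signs(2) unfolding x by simp_all
    then show "x \<in> Tiles (all_directions m)"
      by (simp add: all_directions_def)
  qed
qed

end

(*
  The twisted presheaf T' keeps all vertices, edges and tiles.  If tau sends a tile x to
  delta^C * sigma(delta^C'), then the directions of the edges of x after the reversal are
  sigma(delta^C'), so renumbering the sides and corners of x by the symmetry of the polygon
  corresponding to sigma makes x a tile for C'.  On the geometric realizations nothing happens except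
  that the parametrizations change: the reversed edges by p |-> 1 - p, the tiles by (real linear)
  symmetries of the regular polygon.
*)

theory Submission
  imports Defs
begin

section \<open>Isomorphic gluing data have homeomorphic realizations\<close>

text \<open>Neighbouring tiles share edges, yet the symmetry used on each tile is chosen for that
  tile alone. No clash arises because an edge is reparametrized by a rule that depends only on its
  own sign, while a linear symmetry is affine on each side of the polygon and so either keeps or
  reverses its direction. The formula for the tile component of \<tau> says exactly that the two
  changes agree on every side. The minus signs in \<open>reflect\<close> belong to this bookkeeping:
  reversing the boundary orientation turns a side directed along the boundary into one directed
  against it.

  The dihedral group is available only as words in two list operations. Hence a symmetry is built by
  induction on words, carrying the permutation of sides, the permutation of corners, the orientation
  and the linear map together.\<close>

lemma topspace_quotient_space:
  assumes "equiv (topspace X) r"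
  shows "topspace (quotient_space X r) = topspace X // r"
proof
  show "topspace (quotient_space X r) \<subseteq> topspace X // r"
    using openin_quotient_space[OF assms, of "topspace (quotient_space X r)"] by simp
  have "openin (quotient_space X r) (topspace X // r)"
    by (simp add: openin_quotient_space[OF assms] Union_quotient[OF assms])
  then show "topspace X // r \<subseteq> topspace (quotient_space X r)"
    by (rule openin_subset)
qed

lemma image_equiv_class:
  assumes "equiv A r" "equiv B s" "bij_betw h A B"
    and rel: "\<And>p q. p \<in> A \<Longrightarrow> q \<in> A \<Longrightarrow> (p, q) \<in> r \<longleftrightarrow> (h p, h q) \<in> s"
    and "p \<in> A"
  shows "h ` (r `` {p}) = s `` {h p}"
proof
  show "h ` (r `` {p}) \<subseteq> s `` {h p}"
    using rel assms(5) equiv_class_subset[OF assms(1)] assms(1)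
    by (auto simp: equiv_def refl_on_def)
  show "s `` {h p} \<subseteq> h ` (r `` {p})"
  proof
    fix u assume "u \<in> s `` {h p}"
    then have "(h p, u) \<in> s" "u \<in> B"
      using assms(2) by (auto simp: equiv_def refl_on_def)
    then obtain q where "q \<in> A" "u = h q"
      using assms(3) by (auto simp: bij_betw_def)
    then show "u \<in> h ` (r `` {p})"
      using rel[OF assms(5)] \<open>(h p, u) \<in> s\<close> by blast
  qed
qed

lemma continuous_map_quotient_space:
  assumes r: "equiv (topspace X) r" and s: "equiv (topspace Y) s"
    and h: "homeomorphic_maps X Y h k"
    and rel: "\<And>p q. p \<in> topspace X \<Longrightarrow> q \<in> topspace X \<Longrightarrow> (p, q) \<in> r \<longleftrightarrow> (h p, h q) \<in> s"
  shows "continuous_map (quotient_space X r) (quotient_space Y s) ((`) h)"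
proof -
  have cont: "continuous_map X Y h"
    using h by (simp add: homeomorphic_maps_def)
  have bij: "bij_betw h (topspace X) (topspace Y)"
    using h unfolding homeomorphic_maps_def continuous_map_def
    by (intro bij_betw_byWitness[where f' = k]) auto
  note cls = image_equiv_class[OF r s bij rel]
  have maps: "h ` A \<in> topspace Y // s" if "A \<in> topspace X // r" for A
    using that cls bij_betw_apply[OF bij]
    by (auto elim!: quotientE intro!: quotientI)
  show ?thesis
    unfolding continuous_map_alt
  proof (intro conjI allI impI)
    fix U assume "openin (quotient_space Y s) U"
    then have U: "U \<subseteq> topspace Y // s" "openin Y (\<Union>U)"
      by (simp_all add: openin_quotient_space[OF s])
    have "\<Union>((`) h -` U \<inter> topspace X // r) = {p \<in> topspace X. h p \<in> \<Union>U}"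
    proof (intro equalityI subsetI)
      fix p assume "p \<in> \<Union>((`) h -` U \<inter> topspace X // r)"
      then show "p \<in> {p \<in> topspace X. h p \<in> \<Union>U}"
        using in_quotient_imp_subset[OF r] by blast
    next
      \<comment> \<open>A class in \<open>U\<close> through \<open>h p\<close> must be the class of
        \<open>h p\<close>, which is the image of the class of \<open>p\<close>.\<close>
      fix p assume p: "p \<in> {p \<in> topspace X. h p \<in> \<Union>U}"
      then obtain A where A: "A \<in> U" "h p \<in> A" by blast
      then obtain u where "A = s `` {u}"
        using U(1) by (auto elim: quotientE)
      then have "A = s `` {h p}"
        using equiv_class_eq[OF s] A(2) by blast
      then have "h ` (r `` {p}) \<in> U"
        using A(1) cls p by simp
      then show "p \<in> \<Union>((`) h -` U \<inter> topspace X // r)"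
        using p equiv_class_self[OF r] quotientI[of p "topspace X" r] by blast
    qed
    then show "openin (quotient_space X r) ((`) h -` U \<inter> topspace (quotient_space X r))"
      using openin_continuous_map_preimage[OF cont U(2)]
      by (simp add: openin_quotient_space[OF r] topspace_quotient_space[OF r])
  qed (use maps in \<open>auto simp: topspace_quotient_space r s\<close>)
qed

lemma homeomorphic_quotient_spaces:
  assumes r: "equiv (topspace X) r" and s: "equiv (topspace Y) s"
    and h: "homeomorphic_maps X Y h k"
    and rel: "\<And>p q. p \<in> topspace X \<Longrightarrow> q \<in> topspace X \<Longrightarrow> (p, q) \<in> r \<longleftrightarrow> (h p, h q) \<in> s"
  shows "quotient_space X r homeomorphic_space quotient_space Y s"
proof -
  have hk: "continuous_map X Y h" "continuous_map Y X k"
    "\<And>p. p \<in> topspace X \<Longrightarrow> k (h p) = p" "\<And>p. p \<in> topspace Y \<Longrightarrow> h (k p) = p"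
    using h by (auto simp: homeomorphic_maps_def)
  have rel': "(p, q) \<in> s \<longleftrightarrow> (k p, k q) \<in> r" if "p \<in> topspace Y" "q \<in> topspace Y" for p q
    using that rel[of "k p" "k q"] hk continuous_map_image_subset_topspace[OF hk(2)] by auto
  have "k ` (h ` A) = A" if "A \<in> topspace X // r" for A
  proof -
    have "k (h p) = p" if "p \<in> A" for p
      using hk(3) that \<open>A \<in> topspace X // r\<close> in_quotient_imp_subset[OF r] by blast
    then show ?thesis by force
  qed
  moreover have "h ` (k ` A) = A" if "A \<in> topspace Y // s" for A
  proof -
    have "h (k p) = p" if "p \<in> A" for p
      using hk(4) that \<open>A \<in> topspace Y // s\<close> in_quotient_imp_subset[OF s] by blast
    then show ?thesis by force
  qed
  ultimately have "homeomorphic_maps (quotient_space X r) (quotient_space Y s) ((`) h) ((`) k)"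
    using continuous_map_quotient_space[OF r s h rel]
      continuous_map_quotient_space[OF s r h[unfolded homeomorphic_maps_sym[of X]] rel']
    by (simp add: homeomorphic_maps_def topspace_quotient_space r s)
  then show ?thesis
    by (auto simp: homeomorphic_space_def)
qed

section \<open>Fibrewise homeomorphisms of disjoint sums of cells\<close>

lemma continuous_map_sum_topology_fibrewise:
  assumes "\<And>i. i \<in> I \<Longrightarrow> continuous_map (X i) (Y i) (f i)"
  shows "continuous_map (sum_topology X I) (sum_topology Y I) (\<lambda>(i, p). (i, f i p))"
  unfolding continuous_map_alt
proof (intro conjI allI impI)
  fix U assume U: "openin (sum_topology Y I) U"
  show "openin (sum_topology X I) ((\<lambda>(i, p). (i, f i p)) -` U \<inter> topspace (sum_topology X I))"
    unfolding openin_sum_topology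
  proof (intro conjI ballI)
    fix i assume i: "i \<in> I"
    have "{p. (i, p) \<in> (\<lambda>(i, p). (i, f i p)) -` U \<inter> topspace (sum_topology X I)} =
        {p \<in> topspace (X i). f i p \<in> {q. (i, q) \<in> U}}"
      using i by auto
    then show "openin (X i) {p. (i, p) \<in> (\<lambda>(i, p). (i, f i p)) -` U \<inter> topspace (sum_topology X I)}"
      using openin_continuous_map_preimage[OF assms[OF i], of "{q. (i, q) \<in> U}"] U i
      by (simp add: openin_sum_topology)
  qed auto
qed (use continuous_map_image_subset_topspace[OF assms] in fastforce)

lemma homeomorphic_maps_sum_topology:
  assumes "\<And>i. i \<in> I \<Longrightarrow> homeomorphic_maps (X i) (Y i) (f i) (g i)"
  shows "homeomorphic_maps (sum_topology X I) (sum_topology Y I)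
    (\<lambda>(i, p). (i, f i p)) (\<lambda>(i, p). (i, g i p))"
  using assms continuous_map_sum_topology_fibrewise[of I X Y f]
    continuous_map_sum_topology_fibrewise[of I Y X g]
  by (auto simp: homeomorphic_maps_def)

text \<open>The constructors keep the three sorts apart, so the union in
  \<open>cells_topology\<close> has one member, determined by the element alone. Presheaves with the
  same elements therefore have the same \<open>cells_topology\<close>.\<close>

definition elem_cell :: "nat \<Rightarrow> ('v, 'e, 'f) elem \<Rightarrow> complex set" where
  "elem_cell m x = cell m (case x of Vert _ \<Rightarrow> Ob0 | Edge _ \<Rightarrow> Ob1 | Tile _ \<Rightarrow> Ob2)"

lemma elem_cell: "x \<in> elems T b \<Longrightarrow> elem_cell m x = cell m b"
  by (cases b) (auto simp: elem_cell_def)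

lemma cells_topology_eq:
  "cells_topology m T = sum_topology (\<lambda>x. top_of_set (elem_cell m x)) (\<Union>b. elems T b)"
proof -
  have "(\<Union>b\<in>{b. x \<in> elems T b}. cell m b) = elem_cell m x" if "x \<in> (\<Union>b. elems T b)" for x
    using that elem_cell[of x T _ m] by fastforce
  then show ?thesis
    unfolding cells_topology_def sum_topology_def
    by (intro arg_cong[where f = topology] ext) (auto 0 4 simp: Sigma_def)
qed

lemma topspace_cells: "topspace (cells_topology m T) = Sigma (\<Union>b. elems T b) (elem_cell m)"
  by (auto simp: cells_topology_eq)

lemma glue_in_topspace:
  assumes "m \<ge> 3" "presheaf_on m C T"
  shows "glue m C T \<subseteq> topspace (cells_topology m T) \<times> topspace (cells_topology m T)"
proof -
  have "act T f x \<in> elems T a" "p \<in> elem_cell m (act T f x)"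
    "cell_map m C f p \<in> elem_cell m x"
    if "f \<in> hom_set m a b" "x \<in> elems T b" "p \<in> cell m a" for f x p a b
  proof -
    show *: "act T f x \<in> elems T a"
      using that assms(2) by (auto simp: presheaf_on_def)
    show "p \<in> elem_cell m (act T f x)"
      using that elem_cell[OF *] by simp
    show "cell_map m C f p \<in> elem_cell m x"
      using that cell_map_in_cell[OF assms(1)] elem_cell by fast
  qed
  then show ?thesis
    unfolding glue_def topspace_cells by fast
qed

lemma rtrancl_image:
  assumes "(p, q) \<in> r\<^sup>*" "\<And>p q. (p, q) \<in> r \<Longrightarrow> (h p, h q) \<in> s"
  shows "(h p, h q) \<in> s\<^sup>*"
  using assms(1) by induction (auto intro: assms(2) rtrancl_into_rtrancl)

text \<open>
  An isomorphism of the categories of elements, given by the bijections \<open>\<beta> x\<close> on morphisms,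
  together with a natural family of homeomorphisms \<open>\<phi> x\<close> of the cells.
\<close>

lemma homeomorphic_realizations:
  fixes T T' :: "('v, 'e, 'f) presheaf"
  assumes m: "m \<ge> 3"
    and T: "presheaf_on m C T" and T': "presheaf_on m C' T'"
    and elems: "\<And>b. elems T' b = elems T b"
    and homeo: "\<And>x. x \<in> (\<Union>b. elems T b) \<Longrightarrow>
      homeomorphism (elem_cell m x) (elem_cell m x) (\<phi> x) (\<psi> x)"
    and bij: "\<And>a b x. x \<in> elems T b \<Longrightarrow> bij_betw (\<beta> x) (hom_set m a b) (hom_set m a b)"
    and act: "\<And>a b x f. x \<in> elems T b \<Longrightarrow> f \<in> hom_set m a b \<Longrightarrow> act T (\<beta> x f) x = act T' f x"
    and nat: "\<And>a b x f p. x \<in> elems T b \<Longrightarrow> f \<in> hom_set m a b \<Longrightarrow> p \<in> cell m a \<Longrightarrow>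
      cell_map m C (\<beta> x f) (\<phi> (act T' f x) p) = \<phi> x (cell_map m C' f p)"
  shows "realization m C' T' homeomorphic_space realization m C T"
proof -
  define H where "H = (\<lambda>(x :: ('v, 'e, 'f) elem, p). (x, \<phi> x p))"
  define K where "K = (\<lambda>(x :: ('v, 'e, 'f) elem, p). (x, \<psi> x p))"
  have same: "cells_topology m T' = cells_topology m T"
    by (simp add: cells_topology_eq elems)
  have maps: "homeomorphic_maps (top_of_set S) (top_of_set S) f g" if "homeomorphism S S f g"
    for S :: "complex set" and f g
    using that by (auto simp: homeomorphic_maps_def homeomorphism_def)
  have "homeomorphic_maps (cells_topology m T) (cells_topology m T) H K"
    unfolding H_def K_def cells_topology_eq
    by (intro homeomorphic_maps_sum_topology maps homeo)
  then have HK: "homeomorphic_maps (cells_topology m T') (cells_topology m T) H K"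
    by (simp add: same)
  then have KH: "K (H p) = p" if "p \<in> topspace (cells_topology m T')" for p
    using that by (simp add: homeomorphic_maps_def)
  have homeo_cell: "homeomorphism (cell m b) (cell m b) (\<phi> x) (\<psi> x)" if "x \<in> elems T b" for b x
    using homeo[of x] elem_cell[OF that] that by auto
  have glue1: "(H p, H q) \<in> glue m C T" if "(p, q) \<in> glue m C' T'" for p q
  proof -
    from that obtain f x z a b where pq: "p = (act T' f x, z)" "q = (x, cell_map m C' f z)"
      and f: "f \<in> hom_set m a b" and x: "x \<in> elems T b" and z: "z \<in> cell m a"
      unfolding glue_def elems by blast
    have ax: "act T' f x \<in> elems T a"
      using T' f x elems by (auto simp: presheaf_on_def)
    then have "\<phi> (act T' f x) z \<in> cell m a"
      using homeo_cell[OF ax] z by (auto simp: homeomorphism_def)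
    moreover have "\<beta> x f \<in> hom_set m a b"
      using bij_betw_apply[OF bij[OF x] f] .
    ultimately have "((act T (\<beta> x f) x, \<phi> (act T' f x) z),
        (x, cell_map m C (\<beta> x f) (\<phi> (act T' f x) z))) \<in> glue m C T"
      unfolding glue_def using x by blast
    then show ?thesis
      by (simp add: pq H_def act[OF x f] nat[OF x f z])
  qed
  \<comment> \<open>Naturality is assumed for \<phi> only, so the inverse direction goes through a
    preimage: a generating pair of \<open>glue m C' T'\<close> is built whose image under
    \<open>H\<close> is \<open>(u, w)\<close>. Since it lies in the total space, \<open>K\<close>
    recovers it.\<close>
  have glue2: "(K u, K w) \<in> glue m C' T'" if "(u, w) \<in> glue m C T" for u w
  proof -
    from that obtain g x y a b where uw: "u = (act T g x, y)" "w = (x, cell_map m C g y)"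
      and g: "g \<in> hom_set m a b" and x: "x \<in> elems T b" and y: "y \<in> cell m a"
      unfolding glue_def by blast
    obtain f where f: "f \<in> hom_set m a b" and gf: "g = \<beta> x f"
      using bij[OF x, of a] g unfolding bij_betw_def by blast
    have ax: "act T' f x \<in> elems T a"
      using T' f x elems by (auto simp: presheaf_on_def)
    then have \<phi>: "homeomorphism (cell m a) (cell m a) (\<phi> (act T' f x)) (\<psi> (act T' f x))"
      by (rule homeo_cell)
    define z where "z = \<psi> (act T' f x) y"
    have z: "z \<in> cell m a" "\<phi> (act T' f x) z = y"
      using \<phi> y by (auto simp: homeomorphism_def z_def)
    have pq: "((act T' f x, z), (x, cell_map m C' f z)) \<in> glue m C' T'" (is "(?p, ?q) \<in> _")
      unfolding glue_def elems using f x z by blast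
    have "H ?p = u" "H ?q = w"
      using act[OF x f] nat[OF x f z(1)] z(2) by (simp_all add: H_def uw gf)
    moreover have "?p \<in> topspace (cells_topology m T')" "?q \<in> topspace (cells_topology m T')"
      using glue_in_topspace[OF m T'] pq by blast+
    ultimately have "K u = ?p" "K w = ?q"
      using KH by metis+
    then show ?thesis using pq by simp
  qed
  \<comment> \<open>Matching the generators in both directions suffices:
    \<open>rtrancl_image\<close> carries this over to chains of gluings.\<close>
  have "(p, q) \<in> glue_equiv m C' T' \<longleftrightarrow> (H p, H q) \<in> glue_equiv m C T"
    if pq: "p \<in> topspace (cells_topology m T')" "q \<in> topspace (cells_topology m T')" for p q
  proof -
    have "H p \<in> topspace (cells_topology m T)" "H q \<in> topspace (cells_topology m T)"
      using HK pq continuous_map_image_subset_topspace unfolding homeomorphic_maps_def by fast+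
    moreover have "(H p, H q) \<in> (glue m C T \<union> (glue m C T)\<inverse>)\<^sup>*"
      if "(p, q) \<in> (glue m C' T' \<union> (glue m C' T')\<inverse>)\<^sup>*"
      using that by (rule rtrancl_image) (use glue1 in blast)
    moreover have "(K (H p), K (H q)) \<in> (glue m C' T' \<union> (glue m C' T')\<inverse>)\<^sup>*"
      if "(H p, H q) \<in> (glue m C T \<union> (glue m C T)\<inverse>)\<^sup>*"
      using that by (rule rtrancl_image) (use glue2 in blast)
    ultimately show ?thesis
      using pq by (auto simp: glue_equiv_def KH)
  qed
  then show ?thesis
    unfolding realization_def
    by (intro homeomorphic_quotient_spaces[OF equiv_glue_equiv equiv_glue_equiv HK])
qed


section \<open>Presheaves on $m$-gon categories\<close>

lemma next_index_in: "i \<in> {1..m} \<Longrightarrow> next_index m i \<in> {1..m}"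
  by (auto simp: next_index_def)

lemma next_index_neq: "m \<ge> 3 \<Longrightarrow> next_index m i \<noteq> i"
  by (auto simp: next_index_def)

lemma mgon_comp:
  assumes "mgon_category m C" "i \<in> {1..m}"
  shows "C (MorD i) MorS = MorV (if sign_at C i = 1 then i else next_index m i)"
    and "C (MorD i) MorT = MorV (if sign_at C i = 1 then next_index m i else i)"
proof -
  have "next_index m i \<noteq> i"
    using assms by (intro next_index_neq) (simp add: mgon_category_def)
  moreover have "{C (MorD i) MorS, C (MorD i) MorT} = {MorV i, MorV (next_index m i)}"
    using assms by (simp add: mgon_category_def)
  ultimately show "C (MorD i) MorS = MorV (if sign_at C i = 1 then i else next_index m i)"
    "C (MorD i) MorT = MorV (if sign_at C i = 1 then next_index m i else i)"
    by (auto simp: sign_at_def doubleton_eq_iff)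
qed

lemma hom_set_simps:
  "hom_set m a a = {Ident a}"
  "hom_set m Ob0 Ob1 = {MorS, MorT}"
  "hom_set m Ob1 Ob2 = MorD ` {1..m}"
  "hom_set m Ob0 Ob2 = MorV ` {1..m}"
  "hom_set m Ob1 Ob0 = {}" "hom_set m Ob2 Ob0 = {}" "hom_set m Ob2 Ob1 = {}"
  by (cases a) (auto simp: hom_set_def arrows_def)

lemma all_ob: "(\<forall>a. P a) \<longleftrightarrow> P Ob0 \<and> P Ob1 \<and> P Ob2"
  by (metis ob.exhaust)

text \<open>The only composable pairs without an identity are \<open>MorD i\<close> after
  \<open>MorS\<close> or \<open>MorT\<close>. Functoriality thus reduces to saying which corner is
  the source and which the target of a side, and that is what the sign records.\<close>

lemma presheaf_on_iff:
  assumes "mgon_category m C"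
  shows "presheaf_on m C T \<longleftrightarrow>
    (\<forall>e\<in>Edges T. src T e \<in> Verts T \<and> tgt T e \<in> Verts T) \<and>
    (\<forall>x\<in>Tiles T. \<forall>i\<in>{1..m}. bd T i x \<in> Edges T \<and> corner T i x \<in> Verts T \<and>
       src T (bd T i x) = corner T (if sign_at C i = 1 then i else next_index m i) x \<and>
       tgt T (bd T i x) = corner T (if sign_at C i = 1 then next_index m i else i) x)"
proof -
  have unit: "C f (Ident a) = f" "C (Ident b) f = f" if "f \<in> hom_set m a b" for a b f
    using assms that by (auto simp: mgon_category_def is_category_def)
  have [simp]: "C (Ident a) (Ident a) = Ident a" for a
    by (intro unit(1)[of _ a a]) (simp add: hom_set_simps)
  have [simp]: "C MorS (Ident Ob0) = MorS" "C (Ident Ob1) MorS = MorS"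
    "C MorT (Ident Ob0) = MorT" "C (Ident Ob1) MorT = MorT"
    by (intro unit[of _ Ob0 Ob1]; simp add: hom_set_simps)+
  have [simp]: "C (MorD i) (Ident Ob1) = MorD i" "C (Ident Ob2) (MorD i) = MorD i"
    "C (MorV i) (Ident Ob0) = MorV i" "C (Ident Ob2) (MorV i) = MorV i"
    if "i \<in> {1..m}" for i
    using that by (intro unit[of _ Ob1 Ob2] unit[of _ Ob0 Ob2]; simp add: hom_set_simps)+
  show ?thesis
    unfolding presheaf_on_def
    by (simp add: all_ob hom_set_simps mgon_comp[OF assms] ball_conj_distrib del: atLeastAtMost_iff)
      (auto simp del: atLeastAtMost_iff)
qed

section \<open>Symmetries of the polygon\<close>

text \<open>
  \<open>\<rho>\<close> and \<open>\<kappa>\<close> are the actions on the edges and on the vertices, \<open>\<epsilon>\<close> says that the orientation of the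
  boundary is preserved.  A reflection sends the \<open>j\<close>-th vertex to the end of the image of the
  \<open>j\<close>-th edge, hence the shift between \<open>\<rho>\<close> and \<open>\<kappa>\<close>.
\<close>

definition polygon_symmetry ::
  "nat \<Rightarrow> bool \<Rightarrow> (nat \<Rightarrow> nat) \<Rightarrow> (nat \<Rightarrow> nat) \<Rightarrow> (complex \<Rightarrow> complex) \<Rightarrow> bool" where
  "polygon_symmetry m \<epsilon> \<rho> \<kappa> \<phi> \<longleftrightarrow>
     bij_betw \<rho> {1..m} {1..m} \<and> bij_betw \<kappa> {1..m} {1..m} \<and> linear \<phi> \<and> inj \<phi> \<and>
     (\<forall>j\<in>{1..m}. \<phi> (polygon_vertex m j) = polygon_vertex m (\<kappa> j) \<and>
       \<kappa> j = (if \<epsilon> then \<rho> j else next_index m (\<rho> j)) \<and>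
       \<kappa> (next_index m j) = (if \<epsilon> then next_index m (\<rho> j) else \<rho> j))"

lemma polygon_symmetry_id: "polygon_symmetry m True id id id"
  by (simp add: polygon_symmetry_def linear_id)

text \<open>\<open>\<epsilon>' = \<epsilon>\<close> is the product of the orientation signs. The
  orientation rule of the outer symmetry is applied to side \<open>\<rho> j\<close>, whose two ends
  are the images of the ends of side \<open>j\<close>.\<close>

lemma polygon_symmetry_comp:
  assumes "polygon_symmetry m \<epsilon>' \<rho>' \<kappa>' \<phi>'" "polygon_symmetry m \<epsilon> \<rho> \<kappa> \<phi>"
  shows "polygon_symmetry m (\<epsilon>' = \<epsilon>) (\<rho>' \<circ> \<rho>) (\<kappa>' \<circ> \<kappa>) (\<phi>' \<circ> \<phi>)"
proof -
  have "(\<phi>' \<circ> \<phi>) (polygon_vertex m j) = polygon_vertex m ((\<kappa>' \<circ> \<kappa>) j)"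
    "(\<kappa>' \<circ> \<kappa>) j = (if \<epsilon>' = \<epsilon> then (\<rho>' \<circ> \<rho>) j else next_index m ((\<rho>' \<circ> \<rho>) j))"
    "(\<kappa>' \<circ> \<kappa>) (next_index m j) =
      (if \<epsilon>' = \<epsilon> then next_index m ((\<rho>' \<circ> \<rho>) j) else (\<rho>' \<circ> \<rho>) j)"
    if j: "j \<in> {1..m}" for j
  proof -
    have \<kappa>: "\<phi> (polygon_vertex m j) = polygon_vertex m (\<kappa> j)"
      "\<kappa> j = (if \<epsilon> then \<rho> j else next_index m (\<rho> j))"
      "\<kappa> (next_index m j) = (if \<epsilon> then next_index m (\<rho> j) else \<rho> j)"
      "\<rho> j \<in> {1..m}" "\<kappa> j \<in> {1..m}"
      using assms(2) j by (auto simp: polygon_symmetry_def dest: bij_betw_apply)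
    have "\<phi>' (polygon_vertex m (\<kappa> j)) = polygon_vertex m (\<kappa>' (\<kappa> j))"
      using assms(1) \<kappa>(5) by (simp add: polygon_symmetry_def)
    then show "(\<phi>' \<circ> \<phi>) (polygon_vertex m j) = polygon_vertex m ((\<kappa>' \<circ> \<kappa>) j)"
      using \<kappa>(1) by simp
    have \<kappa>': "\<kappa>' (\<rho> j) = (if \<epsilon>' then \<rho>' (\<rho> j) else next_index m (\<rho>' (\<rho> j)))"
      "\<kappa>' (next_index m (\<rho> j)) = (if \<epsilon>' then next_index m (\<rho>' (\<rho> j)) else \<rho>' (\<rho> j))"
      using assms(1) \<kappa>(4) by (auto simp: polygon_symmetry_def)
    show "(\<kappa>' \<circ> \<kappa>) j = (if \<epsilon>' = \<epsilon> then (\<rho>' \<circ> \<rho>) j else next_index m ((\<rho>' \<circ> \<rho>) j))"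
      "(\<kappa>' \<circ> \<kappa>) (next_index m j) =
        (if \<epsilon>' = \<epsilon> then next_index m ((\<rho>' \<circ> \<rho>) j) else (\<rho>' \<circ> \<rho>) j)"
      by (auto simp: \<kappa>(2,3) \<kappa>')
  qed
  then show ?thesis
    using assms unfolding polygon_symmetry_def
    by (auto simp del: atLeastAtMost_iff comp_apply
        intro: bij_betw_trans linear_compose inj_compose)
qed

definition prev_index :: "nat \<Rightarrow> nat \<Rightarrow> nat" where
  "prev_index m i = (if i = 1 then m else i - 1)"

text \<open>\<open>rotate1\<close> moves entry \<open>j\<close> to the preceding place, so the
  polygon turns backwards by one step.\<close>

lemma polygon_symmetry_rotation:
  assumes "m \<ge> 3"
  shows "polygon_symmetry m True (prev_index m) (prev_index m) ((*) (cis (- (2 * pi / m))))"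
proof -
  have "bij_betw (prev_index m) {1..m} {1..m}"
    by (rule bij_betw_byWitness[where f' = "next_index m"])
      (use assms in \<open>auto simp: prev_index_def next_index_def\<close>)
  moreover have "cis (- (2 * pi / m)) * polygon_vertex m j = polygon_vertex m (prev_index m j)"
    if "j \<in> {1..m}" for j
  proof (cases "j = 1")
    case True
    then show ?thesis using assms
      by (simp add: polygon_vertex_def prev_index_def cis_mult)
  next
    case False
    then have "real (j - 1) = real j - 1" using that by auto
    with False show ?thesis
      by (simp add: polygon_vertex_def prev_index_def cis_mult diff_divide_distrib algebra_simps)
  qed
  moreover have "inj ((*) (cis (- (2 * pi / m))))"
    by (simp add: inj_def)
  moreover have "linear ((*) (cis (- (2 * pi / m))))"
    by (rule linear_times)
  ultimately show ?thesis
    using assms by (auto simp: polygon_symmetry_def prev_index_def next_index_def)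
qed

text \<open>This is the reflection in the line through the centre and vertex 1. It sends the angle
  \<open>t\<close> to \<open>4 * pi / m - t\<close>, hence vertex \<open>j\<close> to
  \<open>2 - j\<close> modulo \<open>m\<close>, and side \<open>j\<close>, between \<open>j\<close>
  and \<open>j + 1\<close>, to the side starting at \<open>1 - j\<close>.\<close>

lemma polygon_symmetry_reflection:
  assumes "m \<ge> 3"
  shows "polygon_symmetry m False (\<lambda>i. m + 1 - i) (\<lambda>i. if i = 1 then 1 else m + 2 - i)
    (\<lambda>z. cis (4 * pi / m) * cnj z)" (is "polygon_symmetry m False ?\<rho> ?\<kappa> ?\<phi>")
proof -
  have "bij_betw ?\<rho> {1..m} {1..m}"
    by (rule bij_betw_byWitness[where f' = ?\<rho>]) auto
  moreover have "bij_betw ?\<kappa> {1..m} {1..m}"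
    by (rule bij_betw_byWitness[where f' = ?\<kappa>]) auto
  moreover have "?\<phi> (polygon_vertex m j) = polygon_vertex m (?\<kappa> j)" if "j \<in> {1..m}" for j
  proof (cases "j = 1")
    case True
    then show ?thesis using assms
      by (simp add: polygon_vertex_def cis_cnj cis_mult flip: diff_divide_distrib)
  next
    case False
    \<comment> \<open>The summand \<open>m\<close> that keeps the index in range contributes one
      full turn, which \<open>cis (2 * pi) = 1\<close> removes.\<close>
    then have "real (m + 2 - j) = real m + 2 - real j" using that by auto
    then have "2 * pi * real (m + 2 - j) / m = 2 * pi + (4 * pi / m + - (2 * pi * j / m))"
      using assms by (simp add: field_simps)
    then have "cis (2 * pi * real (m + 2 - j) / m) = cis (2 * pi) * (cis (4 * pi / m) * cis (- (2 * pi * j / m)))"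
      by (simp only: cis_mult)
    with False show ?thesis
      by (simp add: polygon_vertex_def cis_cnj)
  qed
  moreover have "inj ?\<phi>"
    by (simp add: inj_def)
  moreover have "linear ?\<phi>"
    by (rule linearI) (simp_all add: algebra_simps)
  ultimately show ?thesis
    using assms by (auto simp: polygon_symmetry_def next_index_def)
qed

text \<open>The symmetry is found before \<delta> is quantified, so it depends on the word only. The
  length is part of the induction because indexing into the next list operation requires it.\<close>

lemma dihedral_maps_polygon_symmetry:
  assumes "\<sigma> \<in> dihedral_maps" "m \<ge> 3"
  shows "\<exists>\<epsilon> \<rho> \<kappa> \<phi>. polygon_symmetry m \<epsilon> \<rho> \<kappa> \<phi> \<and>
    (\<forall>\<delta>. length \<delta> = m \<longrightarrow> length (\<sigma> \<delta>) = m \<and>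
      (\<forall>j\<in>{1..m}. \<sigma> \<delta> ! (\<rho> j - 1) = (if \<epsilon> then 1 else -1) * \<delta> ! (j - 1)))"
  using assms(1)
proof induction
  case one
  show ?case
    by (intro exI conjI, rule polygon_symmetry_id) simp
next
  case (rotation \<sigma>)
  then obtain \<epsilon> \<rho> \<kappa> \<phi> where sym: "polygon_symmetry m \<epsilon> \<rho> \<kappa> \<phi>"
    and \<sigma>: "\<And>\<delta>. length \<delta> = m \<Longrightarrow> length (\<sigma> \<delta>) = m \<and>
      (\<forall>j\<in>{1..m}. \<sigma> \<delta> ! (\<rho> j - 1) = (if \<epsilon> then 1 else -1) * \<delta> ! (j - 1))"
    by blast
  have \<rho>: "\<rho> j \<in> {1..m}" if "j \<in> {1..m}" for j
    using sym that by (auto simp: polygon_symmetry_def dest: bij_betw_apply)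
  have rot: "rotate1 \<delta> ! (prev_index m i - 1) = \<delta> ! (i - 1)"
    if "length \<delta> = m" "i \<in> {1..m}" for \<delta> :: "int list" and i
    using that assms(2) by (subst nth_rotate1) (auto simp: prev_index_def)
  \<comment> \<open>The sign is written with \<open>True = \<epsilon>\<close> to have the shape of
    the orientation in \<open>polygon_symmetry_comp\<close>.\<close>
  have "length ((rotate1 \<circ> \<sigma>) \<delta>) = m \<and>
      (\<forall>j\<in>{1..m}. (rotate1 \<circ> \<sigma>) \<delta> ! ((prev_index m \<circ> \<rho>) j - 1) =
        (if True = \<epsilon> then 1 else -1) * \<delta> ! (j - 1))" if "length \<delta> = m" for \<delta>
    using \<sigma>[OF that] rot \<rho> by (simp del: atLeastAtMost_iff)
  then show ?case
    using polygon_symmetry_comp[OF polygon_symmetry_rotation[OF assms(2)] sym] by blast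
next
  case (reflection \<sigma>)
  then obtain \<epsilon> \<rho> \<kappa> \<phi> where sym: "polygon_symmetry m \<epsilon> \<rho> \<kappa> \<phi>"
    and \<sigma>: "\<And>\<delta>. length \<delta> = m \<Longrightarrow> length (\<sigma> \<delta>) = m \<and>
      (\<forall>j\<in>{1..m}. \<sigma> \<delta> ! (\<rho> j - 1) = (if \<epsilon> then 1 else -1) * \<delta> ! (j - 1))"
    by blast
  have \<rho>: "\<rho> j \<in> {1..m}" if "j \<in> {1..m}" for j
    using sym that by (auto simp: polygon_symmetry_def dest: bij_betw_apply)
  have refl: "reflect \<delta> ! (m + 1 - i - 1) = - \<delta> ! (i - 1)"
    if "length \<delta> = m" "i \<in> {1..m}" for \<delta> :: "int list" and i
    using that by (auto simp: reflect_def rev_nth)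
  have "length ((reflect \<circ> \<sigma>) \<delta>) = m \<and>
      (\<forall>j\<in>{1..m}. (reflect \<circ> \<sigma>) \<delta> ! (((\<lambda>i. m + 1 - i) \<circ> \<rho>) j - 1) =
        (if False = \<epsilon> then 1 else -1) * \<delta> ! (j - 1))" if "length \<delta> = m" for \<delta>
  proof (intro conjI ballI)
    show "length ((reflect \<circ> \<sigma>) \<delta>) = m"
      using \<sigma>[OF that] by (simp add: reflect_def)
    fix j assume j: "j \<in> {1..m}"
    show "(reflect \<circ> \<sigma>) \<delta> ! (((\<lambda>i. m + 1 - i) \<circ> \<rho>) j - 1) =
        (if False = \<epsilon> then 1 else -1) * \<delta> ! (j - 1)"
      using \<sigma>[OF that] refl[OF _ \<rho>[OF j], of "\<sigma> \<delta>"] j by (simp del: atLeastAtMost_iff)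
  qed
  then show ?case
    using polygon_symmetry_comp[OF polygon_symmetry_reflection[OF assms(2)] sym] by blast
qed

text \<open>A linear map commutes with convex hulls, so permuting the vertices it maps the polygon
  onto itself. Injectivity makes the inverse linear in finite dimension, hence continuous.\<close>

lemma polygon_symmetry_cell:
  assumes "polygon_symmetry m \<epsilon> \<rho> \<kappa> \<phi>"
  shows "homeomorphism (cell m Ob2) (cell m Ob2) \<phi> (inv \<phi>)"
proof -
  have \<phi>: "linear \<phi>" "inj \<phi>" "bij_betw \<kappa> {1..m} {1..m}"
    "\<And>j. j \<in> {1..m} \<Longrightarrow> \<phi> (polygon_vertex m j) = polygon_vertex m (\<kappa> j)"
    using assms by (auto simp: polygon_symmetry_def)
  have "\<phi> ` polygon_vertex m ` {1..m} = polygon_vertex m ` \<kappa> ` {1..m}"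
    unfolding image_image using \<phi>(4) by (rule image_cong[OF refl])
  then have im: "\<phi> ` cell m Ob2 = cell m Ob2"
    using \<phi>(3) by (simp add: convex_hull_linear_image[OF \<phi>(1)] bij_betw_imp_surj_on)
  have lin: "linear (inv \<phi>)"
    using \<phi>(1,2) by (rule inj_linear_imp_inv_linear)
  have "inv \<phi> ` cell m Ob2 = inv \<phi> ` \<phi> ` cell m Ob2"
    by (simp only: im)
  also have "\<dots> = cell m Ob2"
    using \<phi>(2) by (simp add: image_image)
  finally have im': "inv \<phi> ` cell m Ob2 = cell m Ob2" .
  show ?thesis
    unfolding homeomorphism_def
  proof (intro conjI ballI im im' linear_continuous_on)
    fix y assume "y \<in> cell m Ob2"
    then obtain z where "y = \<phi> z" using im by blast
    then show "\<phi> (inv \<phi> y) = y"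
      using \<phi>(2) by simp
  qed (use lin \<phi> in \<open>simp_all add: linear_linear\<close>)
qed


section \<open>Twisting a presheaf along edge signs and tile symmetries\<close>

text \<open>Renumbering is by precomposition: \<rho> and \<kappa> send the index of a side or corner
  for \<open>C'\<close> to its index for \<open>C\<close>.\<close>

definition twist ::
  "('e \<Rightarrow> int) \<Rightarrow> ('f \<Rightarrow> nat \<Rightarrow> nat) \<Rightarrow> ('f \<Rightarrow> nat \<Rightarrow> nat) \<Rightarrow>
   ('v, 'e, 'f) presheaf \<Rightarrow> ('v, 'e, 'f) presheaf" where
  "twist \<tau> \<rho> \<kappa> T = T \<lparr>
     src := (\<lambda>e. if \<tau> e = -1 then tgt T e else src T e),
     tgt := (\<lambda>e. if \<tau> e = -1 then src T e else tgt T e),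
     bd := (\<lambda>j x. bd T (\<rho> x j) x),
     corner := (\<lambda>j x. corner T (\<kappa> x j) x) \<rparr>"

text \<open>The arrow of \<open>C\<close> whose action on the element equals the twisted action of
  the given arrow; it serves as \<beta> in \<open>homeomorphic_realizations\<close>.\<close>

fun twist_mor ::
  "('e \<Rightarrow> int) \<Rightarrow> ('f \<Rightarrow> nat \<Rightarrow> nat) \<Rightarrow> ('f \<Rightarrow> nat \<Rightarrow> nat) \<Rightarrow> ('v, 'e, 'f) elem \<Rightarrow> mor \<Rightarrow> mor" where
  "twist_mor \<tau> \<rho> \<kappa> (Edge e) MorS = (if \<tau> e = -1 then MorT else MorS)"
| "twist_mor \<tau> \<rho> \<kappa> (Edge e) MorT = (if \<tau> e = -1 then MorS else MorT)"
| "twist_mor \<tau> \<rho> \<kappa> (Tile x) (MorD j) = MorD (\<rho> x j)"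
| "twist_mor \<tau> \<rho> \<kappa> (Tile x) (MorV j) = MorV (\<kappa> x j)"
| "twist_mor \<tau> \<rho> \<kappa> _ f = f"

text \<open>These are the cell homeomorphisms \<phi> of \<open>homeomorphic_realizations\<close>;
  \<open>1 - p\<close> exchanges the ends 0 and 1 that belong to source and target.\<close>

fun twist_cell :: "('e \<Rightarrow> int) \<Rightarrow> ('f \<Rightarrow> complex \<Rightarrow> complex) \<Rightarrow> ('v, 'e, 'f) elem \<Rightarrow> complex \<Rightarrow> complex"
  where
  "twist_cell \<tau> \<phi> (Vert v) p = p"
| "twist_cell \<tau> \<phi> (Edge e) p = (if \<tau> e = -1 then 1 - p else p)"
| "twist_cell \<tau> \<phi> (Tile x) p = \<phi> x p"

lemma homeomorphism_flip_interval: "homeomorphism (cell m Ob1) (cell m Ob1) (\<lambda>p. 1 - p) (\<lambda>p. 1 - p)"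
proof -
  have "(\<lambda>p. 1 - p) ` cell m Ob1 \<subseteq> cell m Ob1"
  proof clarsimp
    fix r :: real assume "0 \<le> r" "r \<le> 1"
    then show "1 - complex_of_real r \<in> complex_of_real ` {0..1}"
      by (intro image_eqI[of _ _ "1 - r"]) auto
  qed
  then show ?thesis
    by (intro homeomorphismI continuous_intros) auto
qed

lemma twist_simps [simp]:
  "Verts (twist \<tau> \<rho> \<kappa> T) = Verts T" "Edges (twist \<tau> \<rho> \<kappa> T) = Edges T"
  "Tiles (twist \<tau> \<rho> \<kappa> T) = Tiles T"
  "src (twist \<tau> \<rho> \<kappa> T) e = (if \<tau> e = -1 then tgt T e else src T e)"
  "tgt (twist \<tau> \<rho> \<kappa> T) e = (if \<tau> e = -1 then src T e else tgt T e)"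
  "bd (twist \<tau> \<rho> \<kappa> T) j x = bd T (\<rho> x j) x"
  "corner (twist \<tau> \<rho> \<kappa> T) j x = corner T (\<kappa> x j) x"
  by (simp_all add: twist_def)

lemma elems_twist [simp]: "elems (twist \<tau> \<rho> \<kappa> T) b = elems T b"
  by (cases b) simp_all

lemma act_twist:
  assumes "x \<in> elems T b" "f \<in> hom_set m a b"
  shows "act (twist \<tau> \<rho> \<kappa> T) f x = act T (twist_mor \<tau> \<rho> \<kappa> x f) x"
  using assms by (cases a; cases b) (auto simp: hom_set_simps)

lemma bij_betw_image_conj:
  assumes "bij_betw \<pi> S S" "inj k" "\<And>j. F (k j) = k (\<pi> j)"
  shows "bij_betw F (k ` S) (k ` S)"
proof -
  have "inj_on F (k ` S)"
    using assms(1) by (auto simp: inj_on_def bij_betw_def assms(3) inj_eq[OF assms(2)])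
  moreover have "F ` k ` S = k ` \<pi> ` S"
    by (simp add: image_image assms(3))
  ultimately show ?thesis
    using assms(1) by (simp add: bij_betw_def)
qed

lemma bij_betw_twist_mor:
  assumes "\<And>x. x \<in> Tiles T \<Longrightarrow> bij_betw (\<rho> x) {1..m} {1..m} \<and> bij_betw (\<kappa> x) {1..m} {1..m}"
    and "x \<in> elems T b"
  shows "bij_betw (twist_mor \<tau> \<rho> \<kappa> x) (hom_set m a b) (hom_set m a b)"
proof -
  have D: "bij_betw (twist_mor \<tau> \<rho> \<kappa> (Tile x)) (MorD ` {1..m}) (MorD ` {1..m})"
    and V: "bij_betw (twist_mor \<tau> \<rho> \<kappa> (Tile x)) (MorV ` {1..m}) (MorV ` {1..m})"
    if "x \<in> Tiles T" for x
    using assms(1)[OF that] bij_betw_image_conj[of "\<rho> x" "{1..m}" MorD]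
      bij_betw_image_conj[of "\<kappa> x" "{1..m}" MorV]
    by (simp_all add: inj_def)
  show ?thesis
    using assms(2)
    by (cases a; cases b)
      (auto simp: hom_set_simps D V bij_betw_def[of _ "{}"] bij_betw_def[of _ "{_}"]
        bij_betw_def[of _ "{_, _}"] split: if_splits simp del: One_nat_def)
qed

lemma tile_edges_twist:
  assumes "bij_betw (\<rho> x) {1..m} {1..m}"
  shows "tile_edges m (twist \<tau> \<rho> \<kappa> T) x = tile_edges m T x"
proof -
  have "(\<lambda>i. bd T (\<rho> x i) x) ` {1..m} = (\<lambda>i. bd T i x) ` \<rho> x ` {1..m}"
    by (simp add: image_image)
  then show ?thesis
    using assms by (simp add: tile_edges_def bij_betw_imp_surj_on)
qed

lemma incident_edges_twist: "incident_edges (twist \<tau> \<rho> \<kappa> T) v = incident_edges T v"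
  by (auto simp: incident_edges_def)

text \<open>At each level the Yoneda map into the twist is the old one precomposed with a
  permutation of the hom-set.\<close>

lemma nonsingular_twist:
  assumes bij: "\<And>x. x \<in> Tiles T \<Longrightarrow> bij_betw (\<rho> x) {1..m} {1..m} \<and> bij_betw (\<kappa> x) {1..m} {1..m}"
    and T: "nonsingular m T"
  shows "nonsingular m (twist \<tau> \<rho> \<kappa> T)"
  unfolding nonsingular_def
proof (intro allI ballI)
  fix a b x assume "x \<in> elems (twist \<tau> \<rho> \<kappa> T) b"
  then have x: "x \<in> elems T b" by simp
  note bij_x = bij_betw_twist_mor[where \<tau> = \<tau> and a = a, OF bij x]
  have "inj_on (\<lambda>g. act T g x) (hom_set m a b)"
    using T x by (simp add: nonsingular_def)
  then have "inj_on ((\<lambda>g. act T g x) \<circ> twist_mor \<tau> \<rho> \<kappa> x) (hom_set m a b)"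
    using bij_x by (intro comp_inj_on) (auto simp: bij_betw_def)
  then show "inj_on (\<lambda>g. act (twist \<tau> \<rho> \<kappa> T) g x) (hom_set m a b)"
    using act_twist[OF x] by (simp cong: inj_on_cong)
qed

text \<open>
  The last hypothesis says that \<open>\<rho> x\<close>, followed by the reversal of the edges of sign \<open>-1\<close>, carries the
  edge directions prescribed by \<open>C'\<close> to those prescribed by \<open>C\<close>.
\<close>

locale twisting =
  fixes m :: nat and C C' :: composition and T :: "('v, 'e, 'f) presheaf"
    and \<tau> :: "'e \<Rightarrow> int" and \<epsilon> :: "'f \<Rightarrow> bool" and \<rho> \<kappa> :: "'f \<Rightarrow> nat \<Rightarrow> nat"
    and \<phi> :: "'f \<Rightarrow> complex \<Rightarrow> complex"
  assumes C: "mgon_category m C" and C': "mgon_category m C'"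
    and T: "presheaf_on m C T"
    and sign: "\<And>e. e \<in> Edges T \<Longrightarrow> \<tau> e \<in> {1, -1}"
    and symmetry: "\<And>x. x \<in> Tiles T \<Longrightarrow> polygon_symmetry m (\<epsilon> x) (\<rho> x) (\<kappa> x) (\<phi> x)"
    and directions: "\<And>x j. x \<in> Tiles T \<Longrightarrow> j \<in> {1..m} \<Longrightarrow>
      \<tau> (bd T (\<rho> x j) x) * sign_at C (\<rho> x j) = (if \<epsilon> x then 1 else -1) * sign_at C' j"
begin

lemma m_ge_3: "m \<ge> 3"
  using C by (simp add: mgon_category_def)

lemma bij:
  assumes "x \<in> Tiles T"
  shows "bij_betw (\<rho> x) {1..m} {1..m} \<and> bij_betw (\<kappa> x) {1..m} {1..m}"
  using symmetry[OF assms] by (simp add: polygon_symmetry_def)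

lemma tile_facts:
  assumes "x \<in> Tiles T" "j \<in> {1..m}"
  shows "\<rho> x j \<in> {1..m}" "\<kappa> x j \<in> {1..m}"
    "\<kappa> x j = (if \<epsilon> x then \<rho> x j else next_index m (\<rho> x j))"
    "\<kappa> x (next_index m j) = (if \<epsilon> x then next_index m (\<rho> x j) else \<rho> x j)"
    "bd T (\<rho> x j) x \<in> Edges T"
    \<comment> \<open>The sign equation as a parity: the sign changes iff exactly one of the two
      happens, reversal of the edge or reversal of the boundary orientation.\<close>
    "sign_at C' j = (if (\<tau> (bd T (\<rho> x j) x) = -1) = \<epsilon> x then - sign_at C (\<rho> x j) else sign_at C (\<rho> x j))"
proof -
  show \<rho>: "\<rho> x j \<in> {1..m}" and "\<kappa> x j \<in> {1..m}"
    using bij[OF assms(1)] assms(2) by (auto dest: bij_betw_apply)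
  show "\<kappa> x j = (if \<epsilon> x then \<rho> x j else next_index m (\<rho> x j))"
    "\<kappa> x (next_index m j) = (if \<epsilon> x then next_index m (\<rho> x j) else \<rho> x j)"
    using symmetry[OF assms(1)] assms(2) by (simp_all add: polygon_symmetry_def)
  show e: "bd T (\<rho> x j) x \<in> Edges T"
    using T assms(1) \<rho> by (simp add: presheaf_on_iff[OF C])
  show "sign_at C' j = (if (\<tau> (bd T (\<rho> x j) x) = -1) = \<epsilon> x then - sign_at C (\<rho> x j) else sign_at C (\<rho> x j))"
    using directions[OF assms] sign[OF e] by (auto split: if_splits)
qed

lemma presheaf_on_twist: "presheaf_on m C' (twist \<tau> \<rho> \<kappa> T)"
  unfolding presheaf_on_iff[OF C']
proof (intro conjI ballI)
  fix x i assume "x \<in> Tiles (twist \<tau> \<rho> \<kappa> T)" and i: "i \<in> {1..m}"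
  then have x: "x \<in> Tiles T" by simp
  note facts = tile_facts[OF x i]
  have Tx: "corner T j x \<in> Verts T"
    "src T (bd T j x) = corner T (if sign_at C j = 1 then j else next_index m j) x"
    "tgt T (bd T j x) = corner T (if sign_at C j = 1 then next_index m j else j) x"
    if "j \<in> {1..m}" for j
    using T x that by (simp_all add: presheaf_on_iff[OF C])
  have val: "sign_at C j = 1 \<or> sign_at C j = -1" for j
    by (simp add: sign_at_def)
  show "bd (twist \<tau> \<rho> \<kappa> T) i x \<in> Edges (twist \<tau> \<rho> \<kappa> T)"
    using facts by simp
  show "corner (twist \<tau> \<rho> \<kappa> T) i x \<in> Verts (twist \<tau> \<rho> \<kappa> T)"
    using facts(2) Tx(1) by simp
  show "src (twist \<tau> \<rho> \<kappa> T) (bd (twist \<tau> \<rho> \<kappa> T) i x) =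
      corner (twist \<tau> \<rho> \<kappa> T) (if sign_at C' i = 1 then i else next_index m i) x"
    "tgt (twist \<tau> \<rho> \<kappa> T) (bd (twist \<tau> \<rho> \<kappa> T) i x) =
      corner (twist \<tau> \<rho> \<kappa> T) (if sign_at C' i = 1 then next_index m i else i) x"
    using facts(3,4,6) Tx(2,3)[OF facts(1)] val[of "\<rho> x i"] by auto
qed (use T in \<open>auto simp: presheaf_on_iff[OF C]\<close>)

text \<open>For a side of a tile both composites are affine paths between two vertices of the
  polygon, so only the order of the end points matters, and the parity of reversals settles
  it.\<close>

lemma cell_map_twist:
  assumes "x \<in> elems T b" "f \<in> hom_set m a b" "p \<in> cell m a"
  shows "cell_map m C (twist_mor \<tau> \<rho> \<kappa> x f) (twist_cell \<tau> \<phi> (act (twist \<tau> \<rho> \<kappa> T) f x) p) =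
    twist_cell \<tau> \<phi> x (cell_map m C' f p)"
proof -
  consider (id) c where "f = Ident c" | (edge) "a = Ob0" "b = Ob1"
    | (tile) "a = Ob1" "b = Ob2" | (corner) "a = Ob0" "b = Ob2"
    using assms(2) by (cases a; cases b) (auto simp: hom_set_simps)
  then show ?thesis
  proof cases
    case id
    then show ?thesis by (cases x) simp_all
  next
    case edge
    then show ?thesis using assms by (auto simp: hom_set_simps)
  next
    case corner
    then show ?thesis using assms symmetry
      by (auto simp: hom_set_simps polygon_symmetry_def)
  next
    case tile
    then obtain y j where y: "x = Tile y" "y \<in> Tiles T" and j: "f = MorD j" "j \<in> {1..m}"
      using assms by (auto simp: hom_set_simps)
    note facts = tile_facts[OF y(2) j(2)]
    have lin: "linear (\<phi> y)"
      and vert: "\<And>i. i \<in> {1..m} \<Longrightarrow> \<phi> y (polygon_vertex m i) = polygon_vertex m (\<kappa> y i)"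
      using symmetry[OF y(2)] by (auto simp: polygon_symmetry_def)
    have "\<phi> y (linepath u w t) = linepath (\<phi> y u) (\<phi> y w) t" for u w t
      by (simp add: linepath_def linear_add[OF lin] linear_scale[OF lin])
    moreover have "linepath u w (1 - t) = linepath w u t" for u w :: complex and t
      by (simp add: linepath_def)
    moreover have "sign_at C (\<rho> y j) = 1 \<or> sign_at C (\<rho> y j) = -1"
      by (simp add: sign_at_def)
    ultimately show ?thesis
      using facts(3,4,6) vert[OF j(2)] vert[OF next_index_in[OF j(2)]]
      by (cases "\<epsilon> y"; cases "\<tau> (bd T (\<rho> y j) y) = -1"; elim disjE; simp add: y j)
  qed
qed

lemma realization_twist:
  "realization m C' (twist \<tau> \<rho> \<kappa> T) homeomorphic_space realization m C T"
proof (rule homeomorphic_realizations[OF m_ge_3 T presheaf_on_twist elems_twist])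
  \<comment> \<open>Flipping an interval is an involution, so only the tile maps have to be
    inverted.\<close>
  let ?\<psi> = "twist_cell \<tau> (\<lambda>x. inv (\<phi> x))"
  show "homeomorphism (elem_cell m x) (elem_cell m x) (twist_cell \<tau> \<phi> x) (?\<psi> x)"
    if "x \<in> (\<Union>b. elems T b)" for x
  proof -
    from that obtain b where "x \<in> elems T b" by blast
    then show ?thesis
    proof (cases x)
      case (Vert v)
      then show ?thesis by (simp add: homeomorphism_def)
    next
      case (Edge e)
      then show ?thesis using homeomorphism_flip_interval[of m]
        by (auto simp: elem_cell_def homeomorphism_def simp del: cell.simps)
    next
      case (Tile y)
      then have "y \<in> Tiles T"
        using \<open>x \<in> elems T b\<close> by (cases b) auto
      then have "homeomorphism (cell m Ob2) (cell m Ob2) (\<phi> y) (inv (\<phi> y))"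
        using polygon_symmetry_cell symmetry by blast
      then show ?thesis
        by (simp add: Tile elem_cell_def homeomorphism_def del: cell.simps)
    qed
  qed
  show "bij_betw (twist_mor \<tau> \<rho> \<kappa> x) (hom_set m a b) (hom_set m a b)" if "x \<in> elems T b" for a b x
    using bij_betw_twist_mor[OF bij that] .
qed (rule act_twist[symmetric] cell_map_twist; assumption)+

text \<open>The conditions on shared edges and on vertex degrees see only the set of sides of a tile
  and the undirected incidences, which the twist preserves.\<close>

lemma directed_tiling_twist:
  assumes "directed_tiling m n C T X"
  shows "directed_tiling m n C' (twist \<tau> \<rho> \<kappa> T) X"
proof -
  have "tile_edges m (twist \<tau> \<rho> \<kappa> T) x = tile_edges m T x" if "x \<in> Tiles T" for x
    using bij[OF that] by (simp add: tile_edges_twist)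
  moreover have "nonsingular m (twist \<tau> \<rho> \<kappa> T)"
    using assms by (intro nonsingular_twist bij) (simp_all add: directed_tiling_def)
  moreover have "realization m C' (twist \<tau> \<rho> \<kappa> T) homeomorphic_space X"
    using assms by (intro homeomorphic_space_trans[OF realization_twist]) (simp add: directed_tiling_def)
  ultimately show ?thesis
    using assms presheaf_on_twist by (simp add: directed_tiling_def incident_edges_twist)
qed

end

section \<open>From the map to the direction presheaf to the data of a twist\<close>

lemma length_sign_tuple [simp]: "length (sign_tuple m C) = m"
  by (simp add: sign_tuple_def)

lemma nth_sign_tuple: "i \<in> {1..m} \<Longrightarrow> sign_tuple m C ! (i - 1) = sign_at C i"
  by (auto simp: sign_tuple_def nth_map nth_upt simp del: upt_Suc)

theorem theorem3p7:
  fixes m n :: nat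
    and C C' :: composition
    and T :: "('v, 'e, 'f) presheaf"
    and X :: "'x topology"
    and \<tau>0 :: "'v \<Rightarrow> unit" and \<tau>1 :: "'e \<Rightarrow> int" and \<tau>2 :: "'f \<Rightarrow> int list"
  assumes "m \<ge> 3" and "n \<ge> 3"
    and "mgon_category m C" and "mgon_category m C'"
    and "directed_tiling m n C T X"
    and "presheaf_map m T (directions m C C') \<tau>0 \<tau>1 \<tau>2"
  shows "\<exists>T' :: ('v, 'e, 'f) presheaf.
           directed_tiling m n C' T' X \<and>
           Verts T' = Verts T \<and> Edges T' = Edges T \<and>
           (\<forall>e\<in>Edges T.
              (\<tau>1 e = -1 \<longrightarrow> src T' e = tgt T e \<and> tgt T' e = src T e) \<and>
              (\<tau>1 e = 1 \<longrightarrow> src T' e = src T e \<and> tgt T' e = tgt T e))"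
proof -
  let ?\<Lambda> = "directions m C C'"
  have T: "presheaf_on m C T"
    using assms(5) by (simp add: directed_tiling_def)
  have \<tau>: "map_elem \<tau>0 \<tau>1 \<tau>2 x \<in> elems ?\<Lambda> b"
    "f \<in> hom_set m a b \<Longrightarrow> map_elem \<tau>0 \<tau>1 \<tau>2 (act T f x) = act ?\<Lambda> f (map_elem \<tau>0 \<tau>1 \<tau>2 x)"
    if "x \<in> elems T b" for x f a b
    using assms(6) that by (auto simp: presheaf_map_def)
  have sign: "\<tau>1 e \<in> {1, -1}" if "e \<in> Edges T" for e
    using \<tau>(1)[of "Edge e" Ob1] that by (auto simp: directions_def all_directions_def)
  have \<tau>1: "\<tau>1 (bd T i x) = \<tau>2 x ! (i - 1)" if "x \<in> Tiles T" "i \<in> {1..m}" for x i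
    using \<tau>(2)[of "Tile x" Ob2 "MorD i" Ob1] that
    by (auto simp: hom_set_simps directions_def all_directions_def)
  have "\<exists>\<epsilon> \<rho> \<kappa> \<phi>. polygon_symmetry m \<epsilon> \<rho> \<kappa> \<phi> \<and>
      (\<forall>j\<in>{1..m}. \<tau>1 (bd T (\<rho> j) x) * sign_at C (\<rho> j) = (if \<epsilon> then 1 else -1) * sign_at C' j)"
    if x: "x \<in> Tiles T" for x
  proof -
    obtain \<sigma> where \<sigma>: "\<sigma> \<in> dihedral_maps"
      and \<tau>2: "\<tau>2 x = map2 (*) (sign_tuple m C) (\<sigma> (sign_tuple m C'))"
      using \<tau>(1)[of "Tile x" Ob2] x by (auto simp: directions_def)
    obtain \<epsilon> \<rho> \<kappa> \<phi> where sym: "polygon_symmetry m \<epsilon> \<rho> \<kappa> \<phi>"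
      and len: "length (\<sigma> (sign_tuple m C')) = m"
      and nth: "\<And>j. j \<in> {1..m} \<Longrightarrow>
        \<sigma> (sign_tuple m C') ! (\<rho> j - 1) = (if \<epsilon> then 1 else -1) * sign_tuple m C' ! (j - 1)"
      using dihedral_maps_polygon_symmetry[OF \<sigma> assms(1)] length_sign_tuple by metis
    have "\<tau>1 (bd T (\<rho> j) x) * sign_at C (\<rho> j) = (if \<epsilon> then 1 else -1) * sign_at C' j"
      if j: "j \<in> {1..m}" for j
    proof -
      have \<rho>: "\<rho> j \<in> {1..m}"
        using sym j by (auto simp: polygon_symmetry_def dest: bij_betw_apply)
      then have "\<rho> j - 1 < m" by auto
      then have "\<tau>1 (bd T (\<rho> j) x) = sign_at C (\<rho> j) * ((if \<epsilon> then 1 else -1) * sign_at C' j)"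
        using nth[OF j] nth_sign_tuple[OF \<rho>] nth_sign_tuple[OF j]
        by (simp add: \<tau>1[OF x \<rho>] \<tau>2 len del: One_nat_def)
      \<comment> \<open>A sign is its own inverse, so the factor from \<open>C\<close> can be moved
        to the side of \<tau>.\<close>
      moreover have "sign_at C (\<rho> j) * sign_at C (\<rho> j) = 1"
        by (simp add: sign_at_def)
      ultimately show ?thesis
        by (simp add: algebra_simps)
    qed
    with sym show ?thesis by blast
  qed
  \<comment> \<open>The choice is made tile by tile, with no condition linking different
    tiles.\<close>
  then obtain \<epsilon> \<rho> \<kappa> \<phi> where
    "\<And>x. x \<in> Tiles T \<Longrightarrow> polygon_symmetry m (\<epsilon> x) (\<rho> x) (\<kappa> x) (\<phi> x) \<and>
      (\<forall>j\<in>{1..m}. \<tau>1 (bd T (\<rho> x j) x) * sign_at C (\<rho> x j) =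
        (if \<epsilon> x then 1 else -1) * sign_at C' j)"
    by metis
  then interpret twisting m C C' T \<tau>1 \<epsilon> \<rho> \<kappa> \<phi>
    by unfold_locales (use assms(3,4) T sign in auto)
  show ?thesis
    by (intro exI[of _ "twist \<tau>1 \<rho> \<kappa> T"]) (simp add: directed_tiling_twist[OF assms(5)])
qed

end
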